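(* Let $X$ be a flow whose underlying topological space is a locally compact $T_3$ space. Then $L^{\mathbf{r}}(X)=P(X)$, $\bar L^{\mathbf{r}}(X)=\overline{\Omega^{\mathbf{r}}(X)}$, and $$L^{\mathbf{r}}(X)=P(X)\subset P^{\mathbf{r}}(X)\subset \Omega^{\mathbf{r}}(X)\subset \overline{\Omega^{\mathbf{r}}(X)}=\bar L^{\mathbf{r}}(X).$$
   Context: A flow on a topological space $X$ is a continuous action $\varphi:\mathbb{R}\times X\to X$, written $\varphi(t,x)=t\cdot x$, with $0\cdot x=x$ and $t\cdot(s\cdot x)=(t+s)\cdot x$. An open set $E\subset X$ is called $\mathbf{r}$-exterior if for every $x\in X$ there is $r_0\in\mathbb{R}$ such that $r\cdot x\in E$ for all $r\ge r_0$; the family of all $\mathbf{r}$-exterior open sets is denoted $\varepsilon^{\mathbf{r}}(X)$. Define $L^{\mathbf{r}}(X)=\bigcap_{E\in\varepsilon^{\mathbf{r}}(X)}E$ and $\bar L^{\mathbf{r}}(X)=\bigcap_{E\in\varepsilon^{\mathbf{r}}(X)}\overline{E}$. For $p\in X$, $\omega^{\mathbf{r}}(p)=\bigcap_{t\ge 0}\overline{[t,+\infty)\cdot p}$ (equivalently, the set of $q$ for which there is a net $t_\delta\to+\infty$ with $t_\delta\cdot p\to q$), and $\Omega^{\mathbf{r}}(X)=\bigcup_{p\in X}\omega^{\mathbf{r}}(p)$. $P(X)$ is the set of periodic points, i.e. points $x$ such that $r\cdot x=x$ for some $r\neq 0$ (critical points, fixed by all $r$, are included). $P^{\mathbf{r}}(X)=\{x\in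 X: x\in\omega^{\mathbf{r}}(x)\}$ is the set of $\mathbf{r}$-Poisson stable points. $T_3$ means regular and $T_1$. *)

theory Defs
  imports "HOL-Analysis.Analysis"
begin

definition flow :: "'a topology \<Rightarrow> (real \<Rightarrow> 'a \<Rightarrow> 'a) \<Rightarrow> bool" where
  "flow X \<phi> \<longleftrightarrow>
     continuous_map (prod_topology euclideanreal X) X (\<lambda>(t, x). \<phi> t x) \<and>
     (\<forall>x \<in> topspace X. \<phi> 0 x = x) \<and>
     (\<forall>t s. \<forall>x \<in> topspace X. \<phi> t (\<phi> s x) = \<phi> (t + s) x)"

definition r_exterior :: "'a topology \<Rightarrow> (real \<Rightarrow> 'a \<Rightarrow> 'a) \<Rightarrow> 'a set \<Rightarrow> bool" where
  "r_exterior X \<phi> E \<longleftrightarrow>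
     openin X E \<and> (\<forall>x \<in> topspace X. \<exists>r0. \<forall>r \<ge> r0. \<phi> r x \<in> E)"

text \<open>The whole space is always r-exterior, so the intersections in the next two
  definitions range over a nonempty family and stay inside the carrier.\<close>

definition limit_space :: "'a topology \<Rightarrow> (real \<Rightarrow> 'a \<Rightarrow> 'a) \<Rightarrow> 'a set" where
  "limit_space X \<phi> = (\<Inter>E \<in> {E. r_exterior X \<phi> E}. E)"

definition bar_limit_space :: "'a topology \<Rightarrow> (real \<Rightarrow> 'a \<Rightarrow> 'a) \<Rightarrow> 'a set" where
  "bar_limit_space X \<phi> = (\<Inter>E \<in> {E. r_exterior X \<phi> E}. X closure_of E)"

definition omega_limit :: "'a topology \<Rightarrow> (real \<Rightarrow> 'a \<Rightarrow> 'a) \<Rightarrow> 'a \<Rightarrow> 'a set" where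
  "omega_limit X \<phi> p = (\<Inter>t \<in> {0..}. X closure_of ((\<lambda>s. \<phi> s p) ` {t..}))"

definition Omega_limit :: "'a topology \<Rightarrow> (real \<Rightarrow> 'a \<Rightarrow> 'a) \<Rightarrow> 'a set" where
  "Omega_limit X \<phi> = (\<Union>p \<in> topspace X. omega_limit X \<phi> p)"

definition periodic_points :: "'a topology \<Rightarrow> (real \<Rightarrow> 'a \<Rightarrow> 'a) \<Rightarrow> 'a set" where
  "periodic_points X \<phi> = {x \<in> topspace X. \<exists>r. r \<noteq> 0 \<and> \<phi> r x = x}"

definition Poisson_stable_points :: "'a topology \<Rightarrow> (real \<Rightarrow> 'a \<Rightarrow> 'a) \<Rightarrow> 'a set" where
  "Poisson_stable_points X \<phi> = {x \<in> topspace X. x \<in> omega_limit X \<phi> x}"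

end

theory Submission
  imports Defs
begin

text \<open>A point that is not periodic is visited at most once by any trajectory, so its complement
  is exterior. A point outside the closure of the omega-limits has a closed compact neighbourhood
  \<open>K\<close> disjoint from all omega-limits; by compactness every trajectory eventually leaves \<open>K\<close>, so the
  complement of \<open>K\<close> is exterior, and its closure misses the point.\<close>

lemma flow_in_topspace:
  assumes "flow X \<phi>" "x \<in> topspace X"
  shows "\<phi> t x \<in> topspace X"
proof -
  have "continuous_map (prod_topology euclideanreal X) X (\<lambda>(t, x). \<phi> t x)"
    using assms(1) by (simp add: flow_def)
  from continuous_map_image_subset_topspace[OF this] show ?thesis
    using assms(2) by (fastforce simp: image_subset_iff)
qed

lemma flow_0:
  assumes "flow X \<phi>" "x \<in> topspace X"
  shows "\<phi> 0 x = x"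
  using assms by (simp add: flow_def)

lemma flow_add:
  assumes "flow X \<phi>" "x \<in> topspace X"
  shows "\<phi> t (\<phi> s x) = \<phi> (t + s) x"
  using assms by (simp add: flow_def)

text \<open>A nonzero period yields a positive one, whose multiples are arbitrarily late return
  times. This puts periodic points both in every exterior set and in their own omega-limits.\<close>

lemma periodic_point_recurs:
  assumes "flow X \<phi>" "x \<in> periodic_points X \<phi>"
  obtains s where "s \<ge> t" "\<phi> s x = x"
proof -
  obtain r where x: "x \<in> topspace X" and r: "r \<noteq> 0" "\<phi> r x = x"
    using assms(2) by (auto simp: periodic_points_def)
  \<comment> \<open>The given period may be negative. Flowing back by \<open>r\<close> shows that
    \<open>- r\<close> is a period too, hence so is its absolute value.\<close>
  have "\<phi> (- r) x = x"
    using flow_add[OF assms(1) x, of "- r" r] flow_0[OF assms(1) x] r by simp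
  then have period: "\<phi> \<bar>r\<bar> x = x"
    using r by (simp add: abs_if)
  have mult: "\<phi> (real n * \<bar>r\<bar>) x = x" for n
  proof (induction n)
    case 0
    show ?case using flow_0[OF assms(1) x] by simp
  next
    case (Suc n)
    then show ?case
      using flow_add[OF assms(1) x, of "real n * \<bar>r\<bar>" "\<bar>r\<bar>"] period
      by (simp add: algebra_simps)
  qed
  obtain n where "t < real n * \<bar>r\<bar>"
    using reals_Archimedean3[of "\<bar>r\<bar>"] r by auto
  with mult that show thesis by (meson less_imp_le)
qed

text \<open>The time between two distinct visits to \<open>x\<close> would be a nonzero period of
  \<open>x\<close>.\<close>

lemma trajectory_meets_nonperiodic_once:
  assumes "flow X \<phi>" "y \<in> topspace X" "x \<notin> periodic_points X \<phi>"
    and "\<phi> s y = x" "\<phi> t y = x"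
  shows "s = t"
proof (rule ccontr)
  assume "s \<noteq> t"
  then have "t - s \<noteq> 0" by simp
  moreover have "\<phi> (t - s) x = x"
    using flow_add[OF assms(1,2), of "t - s" s] assms(4,5) by simp
  moreover have "x \<in> topspace X"
    using flow_in_topspace[OF assms(1,2), of s] assms(4) by simp
  ultimately show False
    using assms(3) unfolding periodic_points_def by blast
qed

lemma r_exterior_topspace:
  assumes "flow X \<phi>"
  shows "r_exterior X \<phi> (topspace X)"
  using flow_in_topspace[OF assms] by (auto simp: r_exterior_def)

lemma r_exterior_delete_nonperiodic:
  assumes "flow X \<phi>" "t1_space X" "x \<in> topspace X" "x \<notin> periodic_points X \<phi>"
  shows "r_exterior X \<phi> (topspace X - {x})"
  unfolding r_exterior_def
proof (intro conjI ballI)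
  show "openin X (topspace X - {x})"
    using assms(2,3) by (simp add: closedin_t1_singleton openin_diff)
next
  fix y assume y: "y \<in> topspace X"
  show "\<exists>r0. \<forall>r\<ge>r0. \<phi> r y \<in> topspace X - {x}"
  proof (cases "\<exists>s. \<phi> s y = x")
    case True
    then obtain s where s: "\<phi> s y = x" ..
    \<comment> \<open>\<open>s\<close> is the only time at which \<open>y\<close> reaches
      \<open>x\<close>. The bound on \<open>r\<close> is inclusive, so it has to lie strictly beyond
      \<open>s\<close>.\<close>
    have "\<phi> r y \<noteq> x" if "r \<ge> s + 1" for r
      using trajectory_meets_nonperiodic_once[OF assms(1) y assms(4) s, of r] that by auto
    then show ?thesis
      using flow_in_topspace[OF assms(1) y] by blast
  next
    case False
    then show ?thesis
      using flow_in_topspace[OF assms(1) y] by blast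
  qed
qed

lemma limit_space_eq_periodic_points:
  assumes "flow X \<phi>" "t1_space X"
  shows "limit_space X \<phi> = periodic_points X \<phi>"
proof
  show "limit_space X \<phi> \<subseteq> periodic_points X \<phi>"
  proof
    fix x assume x: "x \<in> limit_space X \<phi>"
    then have mem: "x \<in> E" if "r_exterior X \<phi> E" for E
      using that by (simp add: limit_space_def)
    show "x \<in> periodic_points X \<phi>"
    proof (rule ccontr)
      assume "x \<notin> periodic_points X \<phi>"
      \<comment> \<open>Exteriority of the whole space first places \<open>x\<close> in the carrier.
        Then the carrier without \<open>x\<close> is exterior and so would have to contain
        \<open>x\<close>.\<close>
      with r_exterior_delete_nonperiodic[OF assms mem[OF r_exterior_topspace[OF assms(1)]]]
      have "x \<in> topspace X - {x}"
        by (intro mem)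
      then show False by simp
    qed
  qed
next
  show "periodic_points X \<phi> \<subseteq> limit_space X \<phi>"
  proof
    fix x assume x: "x \<in> periodic_points X \<phi>"
    have "x \<in> E" if E: "r_exterior X \<phi> E" for E
    proof -
      have "x \<in> topspace X"
        using x by (simp add: periodic_points_def)
      then obtain r0 where r0: "\<forall>r\<ge>r0. \<phi> r x \<in> E"
        using E unfolding r_exterior_def by metis
      obtain s where "s \<ge> r0" "\<phi> s x = x"
        using periodic_point_recurs[OF assms(1) x] .
      with r0 show ?thesis by metis
    qed
    then show "x \<in> limit_space X \<phi>" by (simp add: limit_space_def)
  qed
qed

text \<open>\<open>E\<close> contains a tail of the trajectory of \<open>p\<close>, and an
  omega-limit lies in the closure of each tail.\<close>

lemma omega_limit_subset_closure_of_r_exterior: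
  assumes "r_exterior X \<phi> E" "p \<in> topspace X"
  shows "omega_limit X \<phi> p \<subseteq> X closure_of E"
proof -
  obtain r0 where r0: "\<forall>r\<ge>r0. \<phi> r p \<in> E"
    using assms by (auto simp: r_exterior_def)
  \<comment> \<open>\<open>r0\<close> may be negative, while the tails defining the omega-limit
    start at nonnegative times; hence the maximum with 0.\<close>
  have "omega_limit X \<phi> p \<subseteq> X closure_of ((\<lambda>s. \<phi> s p) ` {max 0 r0..})"
    unfolding omega_limit_def by (rule INF_lower) simp
  also have "\<dots> \<subseteq> X closure_of E"
    using r0 by (intro closure_of_mono) auto
  finally show ?thesis .
qed

text \<open>The closures of the tails are nested closed sets, each meeting \<open>K\<close>, so the
  finite intersection property of \<open>K\<close> gives a common point. Used in contrapositive
  form: a trajectory whose omega-limit misses \<open>K\<close> eventually leaves \<open>K\<close>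
  for good.\<close>

lemma omega_limit_meets_compact:
  assumes "compactin X K" and recurs: "\<And>r. \<exists>t\<ge>r. \<phi> t p \<in> K"
  shows "K \<inter> omega_limit X \<phi> p \<noteq> {}"
proof -
  let ?C = "\<lambda>t. X closure_of ((\<lambda>s. \<phi> s p) ` {t..})"
  have "K \<inter> \<Inter>\<F> \<noteq> {}" if fin: "finite \<F>" and sub: "\<F> \<subseteq> ?C ` {0..}" for \<F>
  proof -
    obtain T where T: "T \<subseteq> {0..}" "finite T" "\<F> = ?C ` T"
      using finite_subset_image[OF fin sub] by blast
    \<comment> \<open>A visit to \<open>K\<close> after an upper bound of the finitely many starting
      times lies in all the chosen tails at once.\<close>
    obtain b where b: "\<And>t. t \<in> T \<Longrightarrow> t \<le> b"
      using \<open>finite T\<close> by (meson bdd_above_def bdd_above_finite)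
    obtain s where s: "s \<ge> b" "\<phi> s p \<in> K"
      using recurs by blast
    \<comment> \<open>A set is contained in its closure only as far as it lies in the carrier. Since
      \<open>p\<close> is arbitrary here, membership in the carrier comes from
      \<open>K\<close>.\<close>
    have "\<phi> s p \<in> topspace X"
      using s(2) compactin_subset_topspace[OF assms(1)] by blast
    then have "\<phi> s p \<in> ?C t" if "t \<in> T" for t
      using closure_of_subset_Int[of X "(\<lambda>s. \<phi> s p) ` {t..}"] b[OF that] s(1) by fastforce
    with s(2) T(3) show ?thesis by auto
  qed
  moreover have "\<forall>C\<in>?C ` {0..}. closedin X C"
    by simp
  ultimately have "K \<inter> \<Inter>(?C ` {0..}) \<noteq> {}"
    using compactin_fip[THEN iffD1, OF assms(1), THEN conjunct2, THEN spec, of "?C ` {0..}"]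
    by blast
  then show ?thesis by (simp add: omega_limit_def)
qed

lemma r_exterior_diff_compact:
  assumes "flow X \<phi>" "compactin X K" "closedin X K" "K \<inter> Omega_limit X \<phi> = {}"
  shows "r_exterior X \<phi> (topspace X - K)"
  unfolding r_exterior_def
proof (intro conjI ballI)
  show "openin X (topspace X - K)"
    using assms(3) by blast
next
  fix p assume p: "p \<in> topspace X"
  have "K \<inter> omega_limit X \<phi> p = {}"
    using assms(4) p by (auto simp: Omega_limit_def)
  then obtain r0 where "\<forall>r\<ge>r0. \<phi> r p \<notin> K"
    using omega_limit_meets_compact[OF assms(2), of \<phi> p] by blast
  then show "\<exists>r0. \<forall>r\<ge>r0. \<phi> r p \<in> topspace X - K"
    using flow_in_topspace[OF assms(1) p] by blast
qed

lemma bar_limit_space_eq_closure_of_Omega_limit: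
  assumes "flow X \<phi>" "locally_compact_space X" "regular_space X"
  shows "bar_limit_space X \<phi> = X closure_of (Omega_limit X \<phi>)"
proof
  show "X closure_of (Omega_limit X \<phi>) \<subseteq> bar_limit_space X \<phi>"
    unfolding bar_limit_space_def Omega_limit_def
    by (intro INF_greatest closure_of_minimal UN_least)
      (auto dest: omega_limit_subset_closure_of_r_exterior)
next
  show "bar_limit_space X \<phi> \<subseteq> X closure_of (Omega_limit X \<phi>)"
  proof (rule ccontr)
    assume "\<not> ?thesis"
    then obtain q where q: "q \<in> bar_limit_space X \<phi>" "q \<notin> X closure_of (Omega_limit X \<phi>)"
      by blast
    have "q \<in> X closure_of topspace X"
      using q(1) r_exterior_topspace[OF assms(1)] unfolding bar_limit_space_def by blast
    then have "q \<in> topspace X - X closure_of (Omega_limit X \<phi>)"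
      using q(2) by simp
    moreover have "openin X (topspace X - X closure_of (Omega_limit X \<phi>))"
      by (simp add: openin_diff)
    \<comment> \<open>Both properties of \<open>K\<close> are used below: compactness makes
      trajectories leave \<open>K\<close>, closedness makes its complement open.\<close>
    moreover have "neighbourhood_base_of (\<lambda>C. compactin X C \<and> closedin X C) X"
      using assms(2,3) locally_compact_regular_space_neighbourhood_base by blast
    ultimately obtain U K where U: "openin X U" "q \<in> U" "U \<subseteq> K"
      and K: "compactin X K" "closedin X K" "K \<subseteq> topspace X - X closure_of (Omega_limit X \<phi>)"
      unfolding neighbourhood_base_of by (metis (no_types, lifting))
    have "Omega_limit X \<phi> \<inter> topspace X \<subseteq> X closure_of (Omega_limit X \<phi>)"
      by (simp add: closure_of_subset_Int inf_commute)
    with K(3) have "K \<inter> Omega_limit X \<phi> = {}"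
      by blast
    then have "q \<in> X closure_of (topspace X - K)"
      using r_exterior_diff_compact[OF assms(1) K(1,2)] q(1) by (auto simp: bar_limit_space_def)
    \<comment> \<open>\<open>U\<close> is an open neighbourhood of \<open>q\<close> inside
      \<open>K\<close>, so it is disjoint from the complement of \<open>K\<close>, whose closure was
      to contain \<open>q\<close>.\<close>
    then show False
      using U by (auto simp: in_closure_of)
  qed
qed

lemma periodic_points_subset_Poisson_stable_points:
  assumes "flow X \<phi>"
  shows "periodic_points X \<phi> \<subseteq> Poisson_stable_points X \<phi>"
proof
  fix x assume x: "x \<in> periodic_points X \<phi>"
  then have xX: "x \<in> topspace X" by (simp add: periodic_points_def)
  have "x \<in> X closure_of ((\<lambda>s. \<phi> s x) ` {t..})" for t
  proof -
    obtain s where "s \<ge> t" "\<phi> s x = x"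
      using periodic_point_recurs[OF assms x] .
    then have "x \<in> (\<lambda>s. \<phi> s x) ` {t..}" by force
    then show ?thesis
      using xX closure_of_subset_Int[of X "(\<lambda>s. \<phi> s x) ` {t..}"] by blast
  qed
  then show "x \<in> Poisson_stable_points X \<phi>"
    using xX by (simp add: Poisson_stable_points_def omega_limit_def)
qed

lemma Poisson_stable_points_subset_Omega_limit:
  "Poisson_stable_points X \<phi> \<subseteq> Omega_limit X \<phi>"
  by (auto simp: Poisson_stable_points_def Omega_limit_def)

text \<open>This is the side condition under which \<open>Omega_limit\<close> is contained in its
  own closure.\<close>

lemma Omega_limit_subset_topspace:
  "Omega_limit X \<phi> \<subseteq> topspace X"
proof -
  have "omega_limit X \<phi> p \<subseteq> X closure_of ((\<lambda>s. \<phi> s p) ` {0..})" for p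
    unfolding omega_limit_def by (rule INF_lower) simp
  then show ?thesis
    unfolding Omega_limit_def by (meson UN_least closure_of_subset_topspace order_trans)
qed

theorem corollary6p14:
  fixes X :: "'a topology" and \<phi> :: "real \<Rightarrow> 'a \<Rightarrow> 'a"
  assumes "flow X \<phi>"
    and "locally_compact_space X"
    and "regular_space X"
    and "t1_space X"
  shows "limit_space X \<phi> = periodic_points X \<phi> \<and>
         bar_limit_space X \<phi> = X closure_of (Omega_limit X \<phi>) \<and>
         (limit_space X \<phi> = periodic_points X \<phi> \<and>
          periodic_points X \<phi> \<subseteq> Poisson_stable_points X \<phi> \<and>
          Poisson_stable_points X \<phi> \<subseteq> Omega_limit X \<phi> \<and>
          Omega_limit X \<phi> \<subseteq> X closure_of (Omega_limit X \<phi>) \<and>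
          X closure_of (Omega_limit X \<phi>) = bar_limit_space X \<phi>)"
  by (intro conjI limit_space_eq_periodic_points[OF assms(1,4)]
      bar_limit_space_eq_closure_of_Omega_limit[OF assms(1-3)]
      bar_limit_space_eq_closure_of_Omega_limit[OF assms(1-3), symmetric]
      periodic_points_subset_Poisson_stable_points[OF assms(1)]
      Poisson_stable_points_subset_Omega_limit
      closure_of_subset[OF Omega_limit_subset_topspace])

end
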